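(* Let $\mathcal I,\mathcal J\subseteq\{1,\dots,n\}$ be nonempty with $\mathcal I\cap\mathcal J=\emptyset$, and let $\mathcal E=\mathcal I\times\mathcal J$. Let $\Pi=\{\pi\in\mathcal S_n:\pi(j)=j\ \forall j\notin\mathcal I\}$, let $A^0\in\{0,1\}^{n\times n}$ and $\mathcal A=\{A^0_\pi:\pi\in\Pi\}$. Assume: (1) $A^2=f(A^1)$, where $A^1,A^2$ are adjacency matrices in $\{0,1\}^{n\times n}$; (2) both $A^1$ and $A^2$ are observed; (3) $P(A^1=A\mid f)=1/|\mathcal A|$ for all $A\in\mathcal A$; (4) for every $(i,j)\in\mathcal E$ and every value $d$ attained by $d_{ij}$ on $\mathcal A$ there is a real number $Y_{ij}^d$ (depending only on $f$) such that for all $A\in\mathcal A$, $d_{ij}(A)=d$ implies $y_{ij}(f(A))=Y_{ij}^d$; (5) $d_{ij}(A_\pi)=d_{\pi(i),\pi(j)}(A)$ for all $\pi\in\Pi$, $(i,j)\in\mathcal E$, $A\in\mathcal A$. Denote $Y_{ij}=y_{ij}(A^2)$ and $D_{ij}=d_{ij}(A^1)\in\mathbb R^k$. For $j\in\mathcal J$ define the multiset of treatment values $\mathcal D_j=[D_{ij}:i\in\mathcal I]$ (which might have repeated entries), and assume that $\sum_{d\in\mathcal D_j}d\cdot d'$ is invertible for all $j\in\mathcal J$. Define $$\widehat\gamma_j=\operatorname*{argmin}_{c}\sum_{i\in\mathcal I}\left(Y_{ij}-D_{ij}\cdot c\right)^2,\qquad \widehat\gamma=\frac1{|\mathcal J|}\sum_{j\in\mathcal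 J}\widehat\gamma_j,$$ $$\gamma_j=\frac1{|\mathcal I|}\sum_{i\in\mathcal I}\left[\left(\sum_{d\in\mathcal D_j}d\cdot d'\right)^{-1}\cdot\left(\sum_{d\in\mathcal D_j}Y_{ij}^d\cdot d\right)\right],\qquad \gamma=\frac1{|\mathcal J|}\sum_{j\in\mathcal J}\gamma_j.$$ Then $E[\widehat\gamma\mid f]=\gamma$. If additionally $\mathcal D_j=\mathcal D$ for all $j\in\mathcal J$, where $\mathcal D\subseteq\mathbb R^k$, then $\gamma=\beta$, where $$\beta=\frac1{|\mathcal E|}\sum_{(i,j)\in\mathcal E}\left[\left(\sum_{d\in\mathcal D}d\cdot d'\right)^{-1}\cdot\left(\sum_{d\in\mathcal D}Y_{ij}^d\cdot d\right)\right].$$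
   Context: $\mathcal S_n$ is the group of all permutations of $\{1,\dots,n\}$. For a matrix $A$ and a permutation $\pi$, $A_\pi$ denotes the matrix with $(i,j)$ entry $A_{\pi(i),\pi(j)}$. The map $f$ on adjacency matrices may be random; $\mathcal A$, $\mathcal E$, $d_{ij}$, $y_{ij}$ are non-random, $d_{ij}$ is $\mathbb R^k$-valued, and $y_{ij}$ is real-valued. Elements of $\mathbb R^k$ are column vectors, $d'$ is the transpose, and $D_{ij}\cdot c$ with $c\in\mathbb R^k$ is the inner product. Sums over $d\in\mathcal D_j$ count repeated entries with multiplicity, and the equality $\mathcal D_j=\mathcal D$ is an equality of multisets. *)

theory Defs
  imports "HOL-Probability.Probability"
begin

text \<open>The vertex set \<open>{1..n}\<close> is rendered by an arbitrary finite index type \<open>'n\<close>,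
  and \<open>\<real>\<^sup>k\<close> by \<^typ>\<open>real^'k\<close>.\<close>

type_synonym 'n graph = "real^'n^'n"

definition adj_matrices :: "('n::finite) graph set" where
  "adj_matrices = {A. \<forall>i j. A $ i $ j \<in> {0, 1}}"

definition relabel :: "('n::finite) graph \<Rightarrow> ('n \<Rightarrow> 'n) \<Rightarrow> 'n graph" where
  "relabel A \<pi> = (\<chi> i j. A $ \<pi> i $ \<pi> j)"

definition perms_fixing_outside :: "'n set \<Rightarrow> ('n::finite \<Rightarrow> 'n) set" where
  "perms_fixing_outside I = {\<pi>. \<pi> permutes UNIV \<and> (\<forall>j. j \<notin> I \<longrightarrow> \<pi> j = j)}"

definition assignments :: "'n set \<Rightarrow> ('n::finite) graph \<Rightarrow> 'n graph set" where
  "assignments I A0 = relabel A0 ` perms_fixing_outside I"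

text \<open>Maps from adjacency matrices to adjacency matrices. They are extensional, so that there are
  finitely many of them, and the discrete \<open>\<sigma>\<close>-algebra is the appropriate one.\<close>

definition graph_maps :: "(('n::finite) graph \<Rightarrow> 'n graph) set" where
  "graph_maps = adj_matrices \<rightarrow>\<^sub>E adj_matrices"

definition sigma_of_map :: "'w measure \<Rightarrow> ('w \<Rightarrow> ('n::finite) graph \<Rightarrow> 'n graph) \<Rightarrow> 'w measure" where
  "sigma_of_map M f = vimage_algebra (space M) f (count_space graph_maps)"

definition vec_cond_exp :: "'w measure \<Rightarrow> 'w measure \<Rightarrow> ('w \<Rightarrow> real^'k) \<Rightarrow> 'w \<Rightarrow> real^'k" where
  "vec_cond_exp M F X \<omega> = (\<chi> l. real_cond_exp M F (\<lambda>\<omega>'. X \<omega>' $ l) \<omega>)"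

definition treatments ::
  "'n set \<Rightarrow> ('n \<Rightarrow> 'n \<Rightarrow> ('n::finite) graph \<Rightarrow> real^'k) \<Rightarrow> 'n graph \<Rightarrow> 'n \<Rightarrow> (real^'k) multiset" where
  "treatments I d A j = image_mset (\<lambda>i. d i j A) (mset_set I)"

definition gram :: "(real^'k) multiset \<Rightarrow> real^'k^'k" where
  "gram D = (\<Sum>d\<in>#D. (columnvector d :: real^1^'k) ** (rowvector d :: real^'k^1))"

definition coef :: "(real^'k) multiset \<Rightarrow> (real^'k \<Rightarrow> real) \<Rightarrow> real^'k" where
  "coef D u = matrix_inv (gram D) *v (\<Sum>d\<in>#D. u d *\<^sub>R d)"

text \<open>\<^const>\<open>arg_min\<close> chooses some minimiser; it is the unique one whenever
  \<^term>\<open>gram (treatments I d A1 j)\<close> is invertible.\<close>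

definition gamma_hat_at ::
  "'n set \<Rightarrow> ('n \<Rightarrow> 'n \<Rightarrow> ('n::finite) graph \<Rightarrow> real^'k) \<Rightarrow> ('n \<Rightarrow> 'n \<Rightarrow> 'n graph \<Rightarrow> real)
    \<Rightarrow> 'n graph \<Rightarrow> 'n graph \<Rightarrow> 'n \<Rightarrow> real^'k" where
  "gamma_hat_at I d y A1 A2 j = (ARG_MIN (\<lambda>c. \<Sum>i\<in>I. (y i j A2 - d i j A1 \<bullet> c)\<^sup>2) c. True)"

definition gamma_hat ::
  "'n set \<Rightarrow> 'n set \<Rightarrow> ('n \<Rightarrow> 'n \<Rightarrow> ('n::finite) graph \<Rightarrow> real^'k) \<Rightarrow> ('n \<Rightarrow> 'n \<Rightarrow> 'n graph \<Rightarrow> real)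
    \<Rightarrow> 'n graph \<Rightarrow> 'n graph \<Rightarrow> real^'k" where
  "gamma_hat I J d y A1 A2 = (1 / real (card J)) *\<^sub>R (\<Sum>j\<in>J. gamma_hat_at I d y A1 A2 j)"

text \<open>In the following, \<open>Y i j v\<close> is the potential outcome of the pair \<open>(i, j)\<close> at the treatment
  value \<open>v\<close>, for one fixed realisation of the map \<open>f\<close>.\<close>

definition gamma_at ::
  "'n set \<Rightarrow> ('n \<Rightarrow> 'n \<Rightarrow> ('n::finite) graph \<Rightarrow> real^'k) \<Rightarrow> ('n \<Rightarrow> 'n \<Rightarrow> real^'k \<Rightarrow> real)
    \<Rightarrow> 'n graph \<Rightarrow> 'n \<Rightarrow> real^'k" where
  "gamma_at I d Y A1 j = (1 / real (card I)) *\<^sub>R (\<Sum>i\<in>I. coef (treatments I d A1 j) (Y i j))"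

definition gamma ::
  "'n set \<Rightarrow> 'n set \<Rightarrow> ('n \<Rightarrow> 'n \<Rightarrow> ('n::finite) graph \<Rightarrow> real^'k) \<Rightarrow> ('n \<Rightarrow> 'n \<Rightarrow> real^'k \<Rightarrow> real)
    \<Rightarrow> 'n graph \<Rightarrow> real^'k" where
  "gamma I J d Y A1 = (1 / real (card J)) *\<^sub>R (\<Sum>j\<in>J. gamma_at I d Y A1 j)"

definition beta ::
  "('n \<times> 'n) set \<Rightarrow> (real^'k) multiset \<Rightarrow> ('n \<Rightarrow> 'n \<Rightarrow> real^'k \<Rightarrow> real) \<Rightarrow> real^'k" where
  "beta E D Y = (1 / real (card E)) *\<^sub>R (\<Sum>(i, j)\<in>E. coef D (Y i j))"

end

theory Submission
  imports Defs
begin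

text \<open>Conditionally on the map \<open>f\<close>, the estimator is a function of the graph \<open>A1\<close> alone, which is
  uniform on \<open>\<A>\<close>, so its conditional expectation is the plain average over \<open>\<A>\<close>. All graphs in \<open>\<A>\<close>
  give the same treatment multiset at \<open>j \<notin> I\<close>, hence the same Gram matrix, so by the normal equations
  only the average of \<open>Y i j (d i j A) *\<^sub>R d i j A\<close> has to be computed. Relabelling by the transposition
  of \<open>i\<close> and \<open>i'\<close> maps \<open>\<A>\<close> to itself and exchanges \<open>d i j\<close> with \<open>d i' j\<close>; so this average is the same
  with \<open>d i' j\<close> in place of \<open>d i j\<close>, and averaging over \<open>i' \<in> I\<close> gives the sum over the treatment
  multiset divided by \<open>card I\<close>.\<close>

section \<open>Least squares\<close>

lemma sum_mset_treatments:
  "(\<Sum>v\<in>#treatments I d A j. u v) = (\<Sum>i\<in>I. u (d i j A))"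
  by (simp add: treatments_def sum_unfold_sum_mset multiset.map_comp comp_def)

lemma outer_product_mult_vec:
  fixes v c :: "real^'k"
  shows "((columnvector v :: real^1^'k) ** (rowvector v :: real^'k^1)) *v c = (v \<bullet> c) *\<^sub>R v"
  by (simp add: vec_eq_iff matrix_vector_mult_def matrix_matrix_mult_def columnvector_def
      rowvector_def inner_vec_def sum_distrib_left sum_distrib_right mult_ac)

text \<open>Lets the normal equations be read as vector sums, without matrix entries.\<close>

lemma gram_mult_vec: "gram D *v c = (\<Sum>v\<in>#D. (v \<bullet> c) *\<^sub>R v)"
proof (induction D)
  case empty
  then show ?case by (simp add: gram_def)
next
  case (add v D)
  then show ?case
    by (simp add: gram_def matrix_vector_mult_add_rdistrib outer_product_mult_vec)
qed

lemma matrix_inv_inverse: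
  assumes "invertible A"
  shows "A ** matrix_inv A = mat 1" and "matrix_inv A ** A = mat 1"
  using someI_ex[OF assms[unfolded invertible_def]] by (simp_all add: matrix_inv_def)

text \<open>The solution \<open>c0\<close> of the normal equations is the only minimiser:
  \<open>S c\<close> exceeds \<open>S c0\<close> by a quadratic form that vanishes only at
  \<open>c = c0\<close>. Uniqueness is what pins down the choice made by
  \<open>ARG_MIN\<close>.\<close>

lemma gamma_hat_at_eq:
  assumes inv: "invertible (gram (treatments I d A1 j))"
  shows "gamma_hat_at I d y A1 A2 j
    = matrix_inv (gram (treatments I d A1 j)) *v (\<Sum>i\<in>I. y i j A2 *\<^sub>R d i j A1)"
proof -
  define G where "G = gram (treatments I d A1 j)"
  define b where "b = (\<Sum>i\<in>I. y i j A2 *\<^sub>R d i j A1)"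
  define c0 where "c0 = matrix_inv G *v b"
  define S where "S = (\<lambda>c. \<Sum>i\<in>I. (y i j A2 - d i j A1 \<bullet> c)\<^sup>2)"
  have G: "G *v c = (\<Sum>i\<in>I. (d i j A1 \<bullet> c) *\<^sub>R d i j A1)" for c
    unfolding G_def gram_mult_vec by (rule sum_mset_treatments)
  have inv_G: "invertible G" using inv by (simp add: G_def)
  have Gc0: "G *v c0 = b"
    using matrix_inv_inverse(1)[OF inv_G] by (simp add: c0_def matrix_vector_mul_assoc)
  \<comment> \<open>The residuals at \<open>c0\<close> are orthogonal to all fitted values, so the
    cross term vanishes when \<open>S c\<close> is expanded around \<open>c0\<close>.\<close>
  have normal: "(\<Sum>i\<in>I. (y i j A2 - d i j A1 \<bullet> c0) * (d i j A1 \<bullet> h)) = 0" for h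
  proof -
    have "(b - G *v c0) \<bullet> h = 0" by (simp add: Gc0)
    then show ?thesis
      by (simp add: G b_def inner_diff_left inner_sum_left sum_subtractf left_diff_distrib)
  qed
  have S_eq: "S c = S c0 + (\<Sum>i\<in>I. (d i j A1 \<bullet> (c - c0))\<^sup>2)" for c
  proof -
    have "S c = S c0 - 2 * (\<Sum>i\<in>I. (y i j A2 - d i j A1 \<bullet> c0) * (d i j A1 \<bullet> (c - c0)))
        + (\<Sum>i\<in>I. (d i j A1 \<bullet> (c - c0))\<^sup>2)"
      unfolding S_def sum_distrib_left sum_subtractf[symmetric] sum.distrib[symmetric]
      by (rule sum.cong) (simp_all add: inner_diff_right power2_eq_square algebra_simps)
    then show ?thesis by (simp add: normal)
  qed
  have unique: "c = c0" if "S c \<le> S c0" for c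
  proof -
    \<comment> \<open>A vanishing sum of squares kills every
      \<open>d i j A1 \<bullet> (c - c0)\<close>, hence also \<open>G *v (c - c0)\<close>, and
      \<open>G\<close> is injective.\<close>
    have "(\<Sum>i\<in>I. (d i j A1 \<bullet> (c - c0))\<^sup>2) = 0"
      using that sum_nonneg[of I "\<lambda>i. (d i j A1 \<bullet> (c - c0))\<^sup>2"] by (simp add: S_eq[of c])
    then have "\<forall>i\<in>I. (d i j A1 \<bullet> (c - c0))\<^sup>2 = 0"
      by (subst (asm) sum_nonneg_eq_0_iff) simp_all
    then have "G *v (c - c0) = 0" by (simp add: G)
    then have "(matrix_inv G ** G) *v (c - c0) = 0"
      by (simp add: matrix_vector_mul_assoc[symmetric])
    then show ?thesis using matrix_inv_inverse(2)[OF inv_G] by simp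
  qed
  have "is_arg_min S (\<lambda>c. True) c \<longleftrightarrow> c = c0" for c
  proof
    assume "is_arg_min S (\<lambda>c. True) c"
    then show "c = c0" by (auto simp: is_arg_min_linorder intro: unique)
  next
    assume "c = c0"
    moreover have "S c0 \<le> S c'" for c'
      by (simp add: S_eq[of c'] sum_nonneg)
    ultimately show "is_arg_min S (\<lambda>c. True) c" by (simp add: is_arg_min_linorder)
  qed
  then have "arg_min S (\<lambda>c. True) = c0" by (simp add: arg_min_def)
  then show ?thesis by (simp add: gamma_hat_at_def S_def c0_def b_def G_def)
qed

section \<open>Relabelling\<close>

lemma perms_fixing_outside_eq: "perms_fixing_outside I = {\<pi>. \<pi> permutes I}"
  by (auto simp: perms_fixing_outside_def permutes_def)

lemma relabel_relabel: "relabel (relabel A \<pi>) \<sigma> = relabel A (\<pi> \<circ> \<sigma>)"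
  by (simp add: relabel_def)

lemma relabel_in_assignments:
  assumes "A \<in> assignments I A0" "\<sigma> permutes I"
  shows "relabel A \<sigma> \<in> assignments I A0"
  using assms
  by (auto simp: assignments_def perms_fixing_outside_eq relabel_relabel intro!: imageI permutes_compose)

text \<open>The permutations of \<open>I\<close> form a group acting on the orbit of
  \<open>A0\<close>, and \<open>inv \<sigma>\<close> supplies the inverse map. This allows sums over
  the orbit to be reindexed.\<close>

lemma bij_betw_relabel_assignments:
  assumes "\<sigma> permutes I"
  shows "bij_betw (\<lambda>A. relabel A \<sigma>) (assignments I A0) (assignments I A0)"
proof (rule bij_betw_byWitness[where f' = "\<lambda>A. relabel A (inv \<sigma>)"])
  have id: "relabel A id = A" for A :: "'a graph" by (simp add: relabel_def)
  show "\<forall>A\<in>assignments I A0. relabel (relabel A \<sigma>) (inv \<sigma>) = A"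
    by (simp add: relabel_relabel permutes_inv_o[OF assms] id)
  show "\<forall>A\<in>assignments I A0. relabel (relabel A (inv \<sigma>)) \<sigma> = A"
    by (simp add: relabel_relabel permutes_inv_o[OF assms] id)
qed (auto intro: relabel_in_assignments assms permutes_inv)

lemma finite_assignments: "finite (assignments (I :: 'n::finite set) A0)"
  by (simp add: assignments_def)

lemma assignments_nonempty: "assignments I A0 \<noteq> {}"
  using permutes_id[of I] by (auto simp: assignments_def perms_fixing_outside_eq simp del: permutes_id)

text \<open>The type of real matrices is infinite, so 0/1 entries are encoded by booleans.
  Finiteness passes on to \<open>graph_maps\<close>.\<close>

lemma finite_adj_matrices: "finite (adj_matrices :: ('n::finite) graph set)"
proof -
  have "adj_matrices \<subseteq> range (\<lambda>b :: 'n \<Rightarrow> 'n \<Rightarrow> bool. (\<chi> i j. of_bool (b i j)) :: 'n graph)"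
  proof
    fix A :: "'n graph" assume "A \<in> adj_matrices"
    then have "A = (\<chi> i j. of_bool (A $ i $ j = 1))"
      by (auto simp: adj_matrices_def vec_eq_iff)
    then show "A \<in> range (\<lambda>b :: 'n \<Rightarrow> 'n \<Rightarrow> bool. (\<chi> i j. of_bool (b i j)) :: 'n graph)"
      by (rule image_eqI[where x = "\<lambda>i j. A $ i $ j = 1"]) simp
  qed
  then show ?thesis by (rule finite_subset) simp
qed

lemma assignments_subset_adj_matrices:
  "A0 \<in> adj_matrices \<Longrightarrow> assignments I A0 \<subseteq> adj_matrices"
  by (simp add: assignments_def relabel_def adj_matrices_def image_subset_iff)

section \<open>Averages over the orbit of \<open>A0\<close>\<close>

context
  fixes I J :: "('n::finite) set" and A0 :: "'n graph" and d :: "'n \<Rightarrow> 'n \<Rightarrow> 'n graph \<Rightarrow> real^'k"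
  assumes disj: "I \<inter> J = {}"
    and equivariant: "\<And>\<pi> i j A. \<pi> permutes I \<Longrightarrow> i \<in> I \<Longrightarrow> j \<in> J \<Longrightarrow> A \<in> assignments I A0
      \<Longrightarrow> d i j (relabel A \<pi>) = d (\<pi> i) (\<pi> j) A"
begin

text \<open>Disjointness puts \<open>j\<close> outside \<open>I\<close>, so \<open>\<pi>\<close>
  fixes it.\<close>

lemma equivariant_left:
  assumes "\<pi> permutes I" "i \<in> I" "j \<in> J" "A \<in> assignments I A0"
  shows "d i j (relabel A \<pi>) = d (\<pi> i) j A"
  using equivariant[OF assms] disj assms permutes_not_in[OF assms(1)] by (metis disjoint_iff)

text \<open>Relabelling only reorders the indices in \<open>I\<close>, which a multiset does not
  see.\<close>

lemma treatments_relabel: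
  assumes \<pi>: "\<pi> permutes I" and j: "j \<in> J" and A: "A \<in> assignments I A0"
  shows "treatments I d (relabel A \<pi>) j = treatments I d A j"
proof -
  have "treatments I d (relabel A \<pi>) j = image_mset (\<lambda>i. d (\<pi> i) j A) (mset_set I)"
    unfolding treatments_def by (rule image_mset_cong) (simp add: equivariant_left[OF \<pi> _ j A])
  also have "\<dots> = image_mset (\<lambda>i. d i j A) (image_mset \<pi> (mset_set I))"
    by (simp add: multiset.map_comp comp_def)
  also have "image_mset \<pi> (mset_set I) = mset_set I"
    using image_mset_mset_set[OF permutes_inj_on[OF \<pi>]] permutes_image[OF \<pi>] by simp
  finally show ?thesis by (simp add: treatments_def)
qed

lemma treatments_eq:
  assumes "j \<in> J" "A \<in> assignments I A0" "B \<in> assignments I A0"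
  shows "treatments I d A j = treatments I d B j"
proof -
  have "A0 \<in> assignments I A0"
    unfolding assignments_def perms_fixing_outside_eq
    by (rule image_eqI[of _ _ id]) (simp_all add: relabel_def permutes_id)
  then have "treatments I d C j = treatments I d A0 j" if "C \<in> assignments I A0" for C
    using that treatments_relabel[OF _ assms(1)]
    by (auto simp: assignments_def perms_fixing_outside_eq)
  then show ?thesis using assms by simp
qed

text \<open>A double count: every \<open>i'\<close> in \<open>I\<close> has the same sum over the
  orbit, while for each \<open>B\<close> the sum over \<open>i'\<close> runs through its treatment
  multiset, which is that of \<open>A\<close>. The function \<open>\<psi>\<close> will be
  \<open>Y i j v *\<^sub>R v\<close>.\<close>

lemma sum_assignments_eq:
  fixes \<psi> :: "real^'k \<Rightarrow> 'b::real_vector"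
  assumes i: "i \<in> I" and j: "j \<in> J" and A: "A \<in> assignments I A0"
  shows "real (card I) *\<^sub>R (\<Sum>B\<in>assignments I A0. \<psi> (d i j B))
    = real (card (assignments I A0)) *\<^sub>R (\<Sum>v\<in>#treatments I d A j. \<psi> v)"
proof -
  have swap: "(\<Sum>B\<in>assignments I A0. \<psi> (d i j B)) = (\<Sum>B\<in>assignments I A0. \<psi> (d i' j B))"
    if "i' \<in> I" for i'
  proof -
    have \<tau>: "Transposition.transpose i i' permutes I" using i that by (rule permutes_swap_id)
    have "(\<Sum>B\<in>assignments I A0. \<psi> (d i j B))
        = (\<Sum>B\<in>assignments I A0. \<psi> (d i j (relabel B (Transposition.transpose i i'))))"
      by (rule sum.reindex_bij_betw[OF bij_betw_relabel_assignments[OF \<tau>], symmetric])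
    also have "\<dots> = (\<Sum>B\<in>assignments I A0. \<psi> (d i' j B))"
      by (rule sum.cong) (simp_all add: equivariant_left[OF \<tau> i j])
    finally show ?thesis .
  qed
  have "real (card I) *\<^sub>R (\<Sum>B\<in>assignments I A0. \<psi> (d i j B))
      = (\<Sum>i'\<in>I. \<Sum>B\<in>assignments I A0. \<psi> (d i j B))"
    by (simp add: sum_constant_scaleR)
  also have "\<dots> = (\<Sum>i'\<in>I. \<Sum>B\<in>assignments I A0. \<psi> (d i' j B))"
    by (rule sum.cong) (simp_all add: swap)
  also have "\<dots> = (\<Sum>B\<in>assignments I A0. \<Sum>i'\<in>I. \<psi> (d i' j B))"
    by (rule sum.swap)
  also have "\<dots> = (\<Sum>B\<in>assignments I A0. \<Sum>v\<in>#treatments I d A j. \<psi> v)"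
    using treatments_eq[OF j _ A] by (intro sum.cong) (simp_all flip: sum_mset_treatments)
  finally show ?thesis by (simp add: sum_constant_scaleR)
qed

text \<open>Here \<open>g\<close> stands for one realisation of the random map, and \<open>A\<close>
  is any representative of the orbit: its inverse Gram matrix serves every \<open>B\<close>, so by
  linearity it can be pulled out of the sum.\<close>

lemma sum_gamma_hat_at:
  assumes j: "j \<in> J" and A: "A \<in> assignments I A0"
    and inv: "invertible (gram (treatments I d A j))"
    and outcome: "\<And>i B. i \<in> I \<Longrightarrow> B \<in> assignments I A0 \<Longrightarrow> y i j (g B) = Y i j (d i j B)"
  shows "(\<Sum>B\<in>assignments I A0. gamma_hat_at I d y B (g B) j)
    = real (card (assignments I A0)) *\<^sub>R gamma_at I d Y A j"
proof (cases "I = {}")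
  \<comment> \<open>Without regressors the closed form of the estimator and \<open>gamma_at\<close>
    are both zero.\<close>
  case True
  then show ?thesis using gamma_hat_at_eq[of "{}" d] inv
    by (simp add: gamma_at_def treatments_def)
next
  case False
  let ?\<A> = "assignments I A0"
  let ?H = "matrix_inv (gram (treatments I d A j))"
  have "(\<Sum>B\<in>?\<A>. gamma_hat_at I d y B (g B) j)
      = (\<Sum>B\<in>?\<A>. ?H *v (\<Sum>i\<in>I. Y i j (d i j B) *\<^sub>R d i j B))"
  proof (rule sum.cong[OF refl])
    fix B assume B: "B \<in> ?\<A>"
    show "gamma_hat_at I d y B (g B) j = ?H *v (\<Sum>i\<in>I. Y i j (d i j B) *\<^sub>R d i j B)"
      using gamma_hat_at_eq[of I d B j y "g B"] inv outcome B
      by (simp add: treatments_eq[OF j B A])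
  qed
  also have "\<dots> = (\<Sum>i\<in>I. ?H *v (\<Sum>B\<in>?\<A>. Y i j (d i j B) *\<^sub>R d i j B))"
    by (simp add: linear_sum[OF matrix_vector_mul_linear] sum.swap[of _ I])
  also have "\<dots> = (\<Sum>i\<in>I. (real (card ?\<A>) / real (card I)) *\<^sub>R coef (treatments I d A j) (Y i j))"
  proof (rule sum.cong[OF refl])
    fix i assume i: "i \<in> I"
    \<comment> \<open>The factor \<open>card I\<close> is inserted and divided out to match the
      multiplied-out form of \<open>sum_assignments_eq\<close>.\<close>
    have "(\<Sum>B\<in>?\<A>. Y i j (d i j B) *\<^sub>R d i j B)
      = (1 / real (card I)) *\<^sub>R real (card I) *\<^sub>R (\<Sum>B\<in>?\<A>. Y i j (d i j B) *\<^sub>R d i j B)"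
      using False by simp
    also have "\<dots> = (real (card ?\<A>) / real (card I)) *\<^sub>R (\<Sum>v\<in>#treatments I d A j. Y i j v *\<^sub>R v)"
      by (simp only: sum_assignments_eq[OF i j A, where \<psi> = "\<lambda>v. Y i j v *\<^sub>R v"]) simp
    finally show "?H *v (\<Sum>B\<in>?\<A>. Y i j (d i j B) *\<^sub>R d i j B)
      = (real (card ?\<A>) / real (card I)) *\<^sub>R coef (treatments I d A j) (Y i j)"
      by (simp only: coef_def matrix_vector_mult_scaleR)
  qed
  finally show ?thesis
    by (simp add: gamma_at_def scaleR_sum_right)
qed

lemma sum_gamma_hat:
  assumes A: "A \<in> assignments I A0"
    and inv: "\<And>j. j \<in> J \<Longrightarrow> invertible (gram (treatments I d A j))"
    and outcome: "\<And>i j B. i \<in> I \<Longrightarrow> j \<in> J \<Longrightarrow> B \<in> assignments I A0 \<Longrightarrow> y i j (g B) = Y i j (d i j B)"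
  shows "(\<Sum>B\<in>assignments I A0. gamma_hat I J d y B (g B))
    = real (card (assignments I A0)) *\<^sub>R gamma I J d Y A"
proof -
  have "(\<Sum>B\<in>assignments I A0. gamma_hat I J d y B (g B))
      = (1 / real (card J)) *\<^sub>R (\<Sum>j\<in>J. \<Sum>B\<in>assignments I A0. gamma_hat_at I d y B (g B) j)"
    by (simp add: gamma_hat_def sum.swap[of _ J] flip: scaleR_sum_right)
  also have "(\<Sum>j\<in>J. \<Sum>B\<in>assignments I A0. gamma_hat_at I d y B (g B) j)
      = (\<Sum>j\<in>J. real (card (assignments I A0)) *\<^sub>R gamma_at I d Y A j)"
    by (intro sum.cong refl sum_gamma_hat_at A inv outcome)
  finally show ?thesis
    by (simp add: gamma_def scaleR_sum_right mult.commute)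
qed

end

text \<open>With a common multiset the summands agree, and an average of averages over
  \<open>I\<close> and \<open>J\<close> is the average over pairs.\<close>

lemma gamma_eq_beta:
  assumes "\<forall>j\<in>J. treatments I d A j = D"
  shows "gamma I J d Y A = beta (I \<times> J) D Y"
proof -
  have "gamma I J d Y A
      = (1 / real (card J)) *\<^sub>R (\<Sum>j\<in>J. (1 / real (card I)) *\<^sub>R (\<Sum>i\<in>I. coef D (Y i j)))"
    unfolding gamma_def gamma_at_def using assms by simp
  also have "\<dots> = beta (I \<times> J) D Y"
    by (simp add: beta_def sum.cartesian_product[symmetric] sum.swap[of _ I]
        card_cartesian_product mult.commute flip: scaleR_sum_right)
  finally show ?thesis .
qed

section \<open>Conditioning on a discrete random variable\<close>

text \<open>Almost surely \<open>Z\<close> is the sum over \<open>x\<close> in \<open>S\<close> of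
  \<open>h (f \<omega>) x\<close> times the indicator of \<open>X = x\<close>. The first factor
  depends on \<open>f\<close> only and can be pulled out; the second has conditional expectation
  \<open>1 / card S\<close>.\<close>

lemma (in prob_space) real_cond_exp_uniform:
  fixes h :: "'b \<Rightarrow> 'c \<Rightarrow> real"
  assumes finT: "finite T" and finU: "finite U" and S: "S \<subseteq> U" "S \<noteq> {}"
    and f: "f \<in> measurable M (count_space T)"
    and X: "X \<in> measurable M (count_space U)"
    and unif: "\<And>x. x \<in> S \<Longrightarrow> AE \<omega> in M.
      real_cond_exp M (vimage_algebra (space M) f (count_space T))
        (indicator {\<omega>'\<in>space M. X \<omega>' = x}) \<omega> = 1 / real (card S)"
    and Z: "Z \<in> borel_measurable M"
    and Z_eq: "AE \<omega> in M. Z \<omega> = h (f \<omega>) (X \<omega>)"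
  shows "AE \<omega> in M. X \<omega> \<in> S"
    and "AE \<omega> in M. real_cond_exp M (vimage_algebra (space M) f (count_space T)) Z \<omega>
      = (\<Sum>x\<in>S. h (f \<omega>) x) / real (card S)"
proof -
  define F where "F = vimage_algebra (space M) f (count_space T)"
  have subalg: "subalgebra M F"
    unfolding subalgebra_def F_def using sets_image_in_sets[OF refl f] by simp
  interpret finite_measure_subalgebra M F
    by unfold_locales (rule subalg)
  have finS: "finite S" using S(1) finU by (rule finite_subset)
  have SU: "x \<in> U" if "x \<in> S" for x using that S(1) by auto
  have cardS: "real (card S) \<noteq> 0" using finS S(2) by simp
  have X_meas [measurable]: "{\<omega>\<in>space M. X \<omega> = x} \<in> sets M" if "x \<in> U" for x
  proof -
    have "X -` {x} \<inter> space M \<in> sets M" using that by (intro measurable_sets[OF X]) simp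
    moreover have "X -` {x} \<inter> space M = {\<omega>\<in>space M. X \<omega> = x}" by auto
    ultimately show ?thesis by simp
  qed
  let ?ind = "\<lambda>x. indicator {\<omega>\<in>space M. X \<omega> = x} :: 'a \<Rightarrow> real"
  have int_ind: "integrable M (?ind x)" if "x \<in> U" for x
    using X_meas[OF that] by (intro integrable_real_indicator) (auto simp: emeasure_eq_measure)
  \<comment> \<open>Integrating the conditional probabilities gives the unconditional ones; since
    they add up to 1 over \<open>S\<close>, no mass lies outside \<open>S\<close>.\<close>
  have prob_eq: "prob {\<omega>\<in>space M. X \<omega> = x} = 1 / real (card S)" if "x \<in> S" for x
  proof -
    have "prob {\<omega>\<in>space M. X \<omega> = x} = (\<integral>\<omega>. ?ind x \<omega> \<partial>M)"
      using sets.sets_into_space[OF X_meas[OF SU[OF that]]] by (simp add: Int_absorb2)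
    also have "\<dots> = (\<integral>\<omega>. real_cond_exp M F (?ind x) \<omega> \<partial>M)"
      using real_cond_exp_int(2)[OF int_ind] that S(1) by auto
    also have "\<dots> = (\<integral>\<omega>. 1 / real (card S) \<partial>M)"
      using unif[OF that] by (intro integral_cong_AE) (simp_all add: F_def)
    finally show ?thesis by (simp add: prob_space)
  qed
  have "prob (\<Union>x\<in>S. {\<omega>\<in>space M. X \<omega> = x}) = (\<Sum>x\<in>S. prob {\<omega>\<in>space M. X \<omega> = x})"
    using finS S(1) X_meas by (intro finite_measure_finite_Union) (auto simp: disjoint_family_on_def)
  also have "\<dots> = 1" using cardS by (simp add: prob_eq)
  finally have "prob (\<Union>x\<in>S. {\<omega>\<in>space M. X \<omega> = x}) = 1" .
  then show in_S: "AE \<omega> in M. X \<omega> \<in> S"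
    by (rule AE_prob_1[THEN AE_mp]) auto
  \<comment> \<open>The target of \<open>f\<close> is discrete, so every function of
    \<open>f\<close> is measurable with respect to \<open>F\<close>.\<close>
  have h_F: "(\<lambda>\<omega>. h (f \<omega>) x) \<in> borel_measurable F" for x
  proof -
    have "f \<in> measurable F (count_space T)"
      unfolding F_def by (intro measurable_vimage_algebra1 funcsetI measurable_space[OF f])
    from measurable_compose[OF this, of "\<lambda>t. h t x" borel] show ?thesis by simp
  qed
  have h_M: "(\<lambda>\<omega>. h (f \<omega>) x) \<in> borel_measurable M" for x
    using h_F measurable_from_subalg[OF subalg] by blast
  have int_h: "integrable M (\<lambda>\<omega>. h (f \<omega>) x * ?ind x \<omega>)" if "x \<in> U" for x
  \<comment> \<open>Since \<open>f\<close> takes values in the finite set \<open>T\<close>, the sum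
    of all possible absolute values is a constant bound.\<close>
  proof (rule integrable_const_bound[where B = "\<Sum>t\<in>T. \<bar>h t x\<bar>"])
    have bound: "\<bar>h (f \<omega>) x\<bar> \<le> (\<Sum>t\<in>T. \<bar>h t x\<bar>)" if "\<omega> \<in> space M" for \<omega>
      using measurable_space[OF f that] finT by (intro member_le_sum) auto
    show "AE \<omega> in M. norm (h (f \<omega>) x * ?ind x \<omega>) \<le> (\<Sum>t\<in>T. \<bar>h t x\<bar>)"
      by (intro AE_I2) (simp add: indicator_def bound sum_nonneg)
    show "(\<lambda>\<omega>. h (f \<omega>) x * ?ind x \<omega>) \<in> borel_measurable M"
      using h_M X_meas[OF that] by (intro borel_measurable_times) auto
  qed
  \<comment> \<open>\<open>real_cond_exp_sum\<close> asks for integrability at every index, also outside \<open>S\<close>.\<close>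
  let ?W = "\<lambda>x \<omega>. if x \<in> S then h (f \<omega>) x * ?ind x \<omega> else 0"
  have int_W: "integrable M (?W x)" for x
    using int_h SU by (cases "x \<in> S") simp_all
  have "AE \<omega> in M. Z \<omega> = (\<Sum>x\<in>S. ?W x \<omega>)"
    using Z_eq in_S AE_space
  proof eventually_elim
    case (elim \<omega>)
    \<comment> \<open>Only the summand with \<open>x = X \<omega>\<close> survives, and it is
      present because \<open>X \<omega>\<close> lies in \<open>S\<close>.\<close>
    have "(\<Sum>x\<in>S. ?W x \<omega>) = (\<Sum>x\<in>S. if X \<omega> = x then h (f \<omega>) x else 0)"
      using elim by (intro sum.cong) (auto simp: indicator_def)
    then show ?case using elim finS by (simp add: sum.delta')
  qed
  then have "AE \<omega> in M. real_cond_exp M F Z \<omega> = real_cond_exp M F (\<lambda>\<omega>. \<Sum>x\<in>S. ?W x \<omega>) \<omega>"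
    using Z borel_measurable_integrable[OF int_W]
    by (intro real_cond_exp_cong borel_measurable_sum)
  moreover have "AE \<omega> in M. real_cond_exp M F (\<lambda>\<omega>. \<Sum>x\<in>S. ?W x \<omega>) \<omega>
      = (\<Sum>x\<in>S. real_cond_exp M F (?W x) \<omega>)"
    by (rule real_cond_exp_sum[OF int_W])
  moreover have "AE \<omega> in M. \<forall>x\<in>S. real_cond_exp M F (?W x) \<omega> = h (f \<omega>) x / real (card S)"
  proof (rule AE_finite_allI[OF finS])
    fix x assume x: "x \<in> S"
    have "AE \<omega> in M. real_cond_exp M F (\<lambda>\<omega>. h (f \<omega>) x * ?ind x \<omega>) \<omega>
        = h (f \<omega>) x * real_cond_exp M F (?ind x) \<omega>"
      using X_meas[OF SU[OF x]] int_h[OF SU[OF x]] by (intro real_cond_exp_mult h_F) auto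
    then show "AE \<omega> in M. real_cond_exp M F (?W x) \<omega> = h (f \<omega>) x / real (card S)"
      using unif[OF x, folded F_def] by eventually_elim (simp add: x)
  qed
  ultimately show "AE \<omega> in M. real_cond_exp M (vimage_algebra (space M) f (count_space T)) Z \<omega>
      = (\<Sum>x\<in>S. h (f \<omega>) x) / real (card S)"
    unfolding F_def[symmetric] by eventually_elim (simp add: sum_divide_distrib)
qed

text \<open>The graph \<open>A1 \<omega>\<close> enters \<open>gamma\<close> only through its
  treatment multisets at \<open>j\<close> in \<open>J\<close>, which are the same for all graphs in
  \<open>\<A>\<close>; so the conditional expectation is almost surely a function of
  \<open>f\<close> alone.\<close>

theorem proposition2:
  fixes M :: "'w measure"
    and I J :: "('n::finite) set"
    and E :: "('n \<times> 'n) set"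
    and A0 :: "'n graph"
    and \<A> :: "'n graph set"
    and A1 A2 :: "'w \<Rightarrow> 'n graph"
    and f :: "'w \<Rightarrow> 'n graph \<Rightarrow> 'n graph"
    and d :: "'n \<Rightarrow> 'n \<Rightarrow> 'n graph \<Rightarrow> real^'k"
    and y :: "'n \<Rightarrow> 'n \<Rightarrow> 'n graph \<Rightarrow> real"
    and Y :: "('n graph \<Rightarrow> 'n graph) \<Rightarrow> 'n \<Rightarrow> 'n \<Rightarrow> real^'k \<Rightarrow> real"
  assumes "prob_space M"
    and "I \<noteq> {}" and "J \<noteq> {}" and "I \<inter> J = {}"
    and "E = I \<times> J"
    and "A0 \<in> adj_matrices"
    and "\<A> = assignments I A0"
    and "f \<in> measurable M (count_space graph_maps)"
    and "A1 \<in> measurable M (count_space adj_matrices)"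
    and "A2 \<in> measurable M (count_space adj_matrices)"
    and "AE \<omega> in M. A2 \<omega> = f \<omega> (A1 \<omega>)"
    and "\<forall>A\<in>\<A>. AE \<omega> in M.
      real_cond_exp M (sigma_of_map M f) (indicator {\<omega>'\<in>space M. A1 \<omega>' = A}) \<omega> = 1 / real (card \<A>)"
    and "AE \<omega> in M. \<forall>(i, j)\<in>E. \<forall>v\<in>d i j ` \<A>. \<forall>A\<in>\<A>. d i j A = v \<longrightarrow> y i j (f \<omega> A) = Y (f \<omega>) i j v"
    and "\<forall>\<pi>\<in>perms_fixing_outside I. \<forall>(i, j)\<in>E. \<forall>A\<in>\<A>. d i j (relabel A \<pi>) = d (\<pi> i) (\<pi> j) A"
    and "AE \<omega> in M. \<forall>j\<in>J. invertible (gram (treatments I d (A1 \<omega>) j))"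
  shows "(AE \<omega> in M. vec_cond_exp M (sigma_of_map M f) (\<lambda>\<omega>'. gamma_hat I J d y (A1 \<omega>') (A2 \<omega>')) \<omega>
            = gamma I J d (Y (f \<omega>)) (A1 \<omega>))
       \<and> (\<forall>\<D>. \<forall>\<omega>\<in>space M. (\<forall>j\<in>J. treatments I d (A1 \<omega>) j = \<D>)
            \<longrightarrow> gamma I J d (Y (f \<omega>)) (A1 \<omega>) = beta E \<D> (Y (f \<omega>)))"
proof -
  interpret prob_space M by fact
  have disj: "I \<inter> J = {}" and \<A>: "\<A> = assignments I A0" by fact+
  have equivariant: "d i j (relabel A \<pi>) = d (\<pi> i) (\<pi> j) A"
    if "\<pi> permutes I" "i \<in> I" "j \<in> J" "A \<in> assignments I A0" for \<pi> i j A
    using assms(14) that by (auto simp: \<A> assms(5) perms_fixing_outside_eq)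
  have \<A>_sub: "\<A> \<subseteq> adj_matrices" "\<A> \<noteq> {}"
    using assignments_subset_adj_matrices[OF assms(6)] assignments_nonempty by (simp_all add: \<A>)
  have card_\<A>: "card \<A> \<noteq> 0"
    using \<A>_sub(2) finite_assignments[of I A0] by (simp add: \<A>)
  have fin_maps: "finite (graph_maps :: ('n graph \<Rightarrow> 'n graph) set)"
    unfolding graph_maps_def by (intro finite_PiE finite_adj_matrices)
  let ?X = "\<lambda>\<omega>. gamma_hat I J d y (A1 \<omega>) (A2 \<omega>)"
  \<comment> \<open>The pair of graphs takes values in a finite discrete space, so any function of
    it is measurable, including one defined by \<open>ARG_MIN\<close>.\<close>
  have X_meas: "(\<lambda>\<omega>. ?X \<omega> $ l) \<in> borel_measurable M" for l
  proof -
    have "(\<lambda>\<omega>. (A1 \<omega>, A2 \<omega>)) \<in> measurable M (count_space (adj_matrices \<times> adj_matrices))"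
      using measurable_Pair[OF assms(9,10)]
      unfolding pair_measure_countable[OF countable_finite countable_finite,
        OF finite_adj_matrices finite_adj_matrices] .
    from measurable_compose[OF this, of "\<lambda>(a, b). gamma_hat I J d y a b $ l" borel]
    show ?thesis by simp
  qed
  \<comment> \<open>The function \<open>h\<close> stays schematic; \<open>X_eq\<close> instantiates
    it with component \<open>l\<close> of the estimator, seen as a function of the map and the first
    graph.\<close>
  note cond = real_cond_exp_uniform[OF fin_maps finite_adj_matrices \<A>_sub assms(8,9)
      assms(12)[unfolded sigma_of_map_def, rule_format] X_meas,
      folded sigma_of_map_def]
  have X_eq: "AE \<omega> in M. ?X \<omega> $ l = gamma_hat I J d y (A1 \<omega>) (f \<omega> (A1 \<omega>)) $ l" for l
    using assms(11) by eventually_elim simp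
  have A1_in: "AE \<omega> in M. A1 \<omega> \<in> \<A>"
    by (rule cond(1)[OF _ X_eq])
  have "AE \<omega> in M. \<forall>l\<in>UNIV. real_cond_exp M (sigma_of_map M f) (\<lambda>\<omega>. ?X \<omega> $ l) \<omega>
      = (\<Sum>A\<in>\<A>. gamma_hat I J d y A (f \<omega> A) $ l) / real (card \<A>)"
    by (intro AE_finite_allI cond(2)[OF _ X_eq]) simp_all
  then have "AE \<omega> in M. vec_cond_exp M (sigma_of_map M f) ?X \<omega> = gamma I J d (Y (f \<omega>)) (A1 \<omega>)"
    using A1_in assms(13,15)
  proof eventually_elim
    case (elim \<omega>)
    \<comment> \<open>For fixed \<open>\<omega>\<close> the realised map \<open>f \<omega>\<close>
      takes the role of \<open>g\<close>, and \<open>A1 \<omega>\<close> is the representative of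
      the orbit, whose Gram matrices are invertible.\<close>
    have "(\<Sum>A\<in>\<A>. gamma_hat I J d y A (f \<omega> A)) = real (card \<A>) *\<^sub>R gamma I J d (Y (f \<omega>)) (A1 \<omega>)"
      unfolding \<A> using elim 
      by (intro sum_gamma_hat disj equivariant) (auto simp: \<A> assms(5))
    then have "(\<Sum>A\<in>\<A>. gamma_hat I J d y A (f \<omega> A) $ l) = real (card \<A>) * gamma I J d (Y (f \<omega>)) (A1 \<omega>) $ l"
      for l by (simp flip: sum_component)
    then show ?case
      using elim(1) card_\<A> by (simp add: vec_cond_exp_def vec_eq_iff)
  qed
  then show ?thesis by (simp add: gamma_eq_beta assms(5))
qed

end
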